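(* Let a POMDP be given, let $r$ be the rank of the multiplicity automaton representing it (the rank of its Hankel matrix), and let $T$ be the set of tests output by Algorithm 1 (described in the context). Then there exists a set of states $B\subset S$ with $|B|=r$ such that, for every belief state $b$, the vector $F_b^T$ can be uniquely represented as $F_b^T=\sum_{\tilde b\in B}\alpha_{\tilde b}F_{\tilde b}^T$ with real coefficients, and these satisfy $\max_{\tilde b\in B}|\alpha_{\tilde b}|\le 2$.
   Context: A POMDP consists of a finite state set $S=\{s_1,\dots,s_n\}$; a finite action set $A$; transition probabilities $P(s,a,s')$; a finite set of observable signals $\Omega=O\times R$, where $O$ is the observation set and $R\subset[0,1]$ is the set of immediate rewards; and observation probabilities $OB(o\mid s,a)$ for $o\in\Omega$. A belief state is a probability distribution over $S$; a state $s\in S$ is identified with the belief state concentrated on $s$. Write $\mathbf{P}(s',o\mid a,s)=OB(o\mid s,a)P(s,a,s')$. A test is a word over $\Sigma=A\times\Omega$, with $\lambda$ the empty word. Its success probability is given by $\mathbf{P}(\lambda\mid s)=1$, $\mathbf{P}((a,o)\circ t\mid s)=\sum_{s'}\mathbf{P}(s',o\mid a,s)\mathbf{P}(t\mid s')$, and $\mathbf{P}(t\mid b)=\sum_i b(i)\mathbf{P}(t\mid s_i)$. The Hankel matrix of the POMDP is the infinite matrix with rows indexed by belief states $b$, columns indexed by tests $t$, and entries $\mathbf{P}(t\mid b)$. For a finite list of tests $T=\{t_1,\dots,t_m\}$ and a belief state $b$, $F_b^T\in\mathbb{R}^m$ is the vector with $F_b^T(i)=\mathbf{P}(t_i\mid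 b)$. Algorithm 1: initialize $B\leftarrow\{s_1\}$, $T\leftarrow\{\lambda\}$. While there exist $\sigma\in\Sigma$, $b\in S\setminus B$, coefficients $(\alpha_i)$ and $y\in T$ such that $F_b^T=\sum_{b_i\in B}\alpha_iF_{b_i}^T$ and $\mathbf{P}(\sigma\circ y\mid b)\ne\sum_{b_i\in B}\alpha_i\mathbf{P}(\sigma\circ y\mid b_i)$, set $B\leftarrow B\cup\{b\}$ and $T\leftarrow T\cup\{\sigma\circ y\}$. Output $B$ and $T$. *)

theory Defs
  imports "HOL-Probability.Probability_Mass_Function" "HOL-Library.Function_Algebras"
begin

record ('s, 'a, 'o) pomdp =
  states :: "'s set"
  actions :: "'a set"
  observations :: "'o set"
  rewards :: "real set"
  trans :: "'s \<Rightarrow> 'a \<Rightarrow> 's pmf"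
  obs :: "'s \<Rightarrow> 'a \<Rightarrow> ('o \<times> real) pmf"

definition signals :: "('s, 'a, 'o) pomdp \<Rightarrow> ('o \<times> real) set" where
  "signals M = observations M \<times> rewards M"

definition is_pomdp :: "('s, 'a, 'o) pomdp \<Rightarrow> bool" where
  "is_pomdp M \<longleftrightarrow>
     finite (states M) \<and> finite (actions M) \<and> finite (observations M) \<and>
     finite (rewards M) \<and> rewards M \<subseteq> {0..1} \<and>
     (\<forall>s\<in>states M. \<forall>a\<in>actions M.
        set_pmf (trans M s a) \<subseteq> states M \<and> set_pmf (obs M s a) \<subseteq> signals M)"

text \<open>A state \<open>s\<close> is identified with the belief state \<open>return_pmf s\<close>.\<close>

definition belief_states :: "('s, 'a, 'o) pomdp \<Rightarrow> 's pmf set" where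
  "belief_states M = {b. set_pmf b \<subseteq> states M}"

text \<open>\<open>joint_prob M s' w a s\<close> is \<open>P(s', w | a, s)\<close>; the signal is drawn according to the
  state \<open>s\<close> in which the action is taken.\<close>

definition joint_prob :: "('s, 'a, 'o) pomdp \<Rightarrow> 's \<Rightarrow> 'o \<times> real \<Rightarrow> 'a \<Rightarrow> 's \<Rightarrow> real" where
  "joint_prob M s' w a s = pmf (obs M s a) w * pmf (trans M s a) s'"

type_synonym ('a, 'o) test = "('a \<times> 'o \<times> real) list"

definition alphabet :: "('s, 'a, 'o) pomdp \<Rightarrow> ('a \<times> 'o \<times> real) set" where
  "alphabet M = actions M \<times> signals M"

definition tests :: "('s, 'a, 'o) pomdp \<Rightarrow> ('a, 'o) test set" where
  "tests M = lists (alphabet M)"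

fun state_prob :: "('s, 'a, 'o) pomdp \<Rightarrow> ('a, 'o) test \<Rightarrow> 's \<Rightarrow> real" where
  "state_prob M [] s = 1"
| "state_prob M ((a, w) # t) s =
     (\<Sum>s'\<in>states M. joint_prob M s' w a s * state_prob M t s')"

definition test_prob :: "('s, 'a, 'o) pomdp \<Rightarrow> ('a, 'o) test \<Rightarrow> 's pmf \<Rightarrow> real" where
  "test_prob M t b = (\<Sum>s\<in>states M. pmf b s * state_prob M t s)"

lemma test_prob_return_pmf:
  assumes "finite (states M)" "s \<in> states M"
  shows "test_prob M t (return_pmf s) = state_prob M t s"
proof -
  have "test_prob M t (return_pmf s)
      = (\<Sum>x\<in>states M. if x = s then state_prob M t x else 0)"
    unfolding test_prob_def by (intro sum.cong) (auto simp: indicator_def)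
  then show ?thesis using assms by simp
qed

text \<open>Vectors indexed by a set \<open>T\<close> of tests are encoded as functions on all words that vanish
  outside \<open>T\<close>. Thus \<open>test_vector M T b\<close> is the vector \<open>F\<^sub>b\<^sup>T\<close> when \<open>T\<close> is finite, and \<open>test_vector M (tests M) b\<close> is
  the full row of \<open>b\<close> in the Hankel matrix.\<close>

definition test_vector ::
  "('s, 'a, 'o) pomdp \<Rightarrow> ('a, 'o) test set \<Rightarrow> 's pmf \<Rightarrow> ('a, 'o) test \<Rightarrow> real" where
  "test_vector M T b = (\<lambda>t. if t \<in> T then test_prob M t b else 0)"

interpretation real_fun: vector_space "\<lambda>(c::real) (f :: 'i \<Rightarrow> real) i. c * f i"
  by unfold_locales (auto simp: fun_eq_iff algebra_simps)

text \<open>The rank of the Hankel matrix is the dimension of its row space. It is finite, since every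
  row is a linear combination of the rows of the finitely many states.\<close>

definition hankel_rank :: "('s, 'a, 'o) pomdp \<Rightarrow> nat" where
  "hankel_rank M = real_fun.dim (test_vector M (tests M) ` belief_states M)"

text \<open>\<open>represents M T B \<alpha> b\<close> says that \<open>F\<^sub>b\<^sup>T\<close> is the linear combination of the vectors
  of the states in \<open>B\<close> with coefficients \<open>\<alpha>\<close>.\<close>

definition represents ::
  "('s, 'a, 'o) pomdp \<Rightarrow> ('a, 'o) test set \<Rightarrow> 's set \<Rightarrow> ('s \<Rightarrow> real) \<Rightarrow> 's pmf \<Rightarrow> bool" where
  "represents M T B \<alpha> b \<longleftrightarrow>
     test_vector M T b = (\<lambda>t. \<Sum>s\<in>B. \<alpha> s * test_vector M T (return_pmf s) t)"

definition extendable ::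
  "('s, 'a, 'o) pomdp \<Rightarrow> 's set \<Rightarrow> ('a, 'o) test set \<Rightarrow> 's \<Rightarrow> 'a \<times> 'o \<times> real \<Rightarrow> ('a, 'o) test \<Rightarrow> bool"
  where
  "extendable M B T b \<sigma> y \<longleftrightarrow>
     \<sigma> \<in> alphabet M \<and> b \<in> states M - B \<and> y \<in> T \<and>
     (\<exists>\<alpha>. represents M T B \<alpha> (return_pmf b) \<and>
          test_prob M (\<sigma> # y) (return_pmf b)
            \<noteq> (\<Sum>s\<in>B. \<alpha> s * test_prob M (\<sigma> # y) (return_pmf s)))"

text \<open>The loop of the algorithm is nondeterministic: any witness of the loop condition may be
  chosen. \<open>alg_reaches M s\<^sub>1 B T\<close> says that some run started from the state \<open>s\<^sub>1\<close> passes through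
  \<open>(B, T)\<close>, and \<open>alg_output\<close> that the loop moreover stops there.\<close>

inductive alg_reaches ::
  "('s, 'a, 'o) pomdp \<Rightarrow> 's \<Rightarrow> 's set \<Rightarrow> ('a, 'o) test set \<Rightarrow> bool" for M s1 where
  init: "alg_reaches M s1 {s1} {[]}"
| step: "alg_reaches M s1 B T \<Longrightarrow> extendable M B T b \<sigma> y \<Longrightarrow>
         alg_reaches M s1 (B \<union> {b}) (T \<union> {\<sigma> # y})"

definition alg_output ::
  "('s, 'a, 'o) pomdp \<Rightarrow> 's \<Rightarrow> 's set \<Rightarrow> ('a, 'o) test set \<Rightarrow> bool" where
  "alg_output M s1 B T \<longleftrightarrow>
     alg_reaches M s1 B T \<and> \<not> (\<exists>b \<sigma> y. extendable M B T b \<sigma> y)"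

end

theory Submission
  imports Defs "Jordan_Normal_Form.Determinant"
begin

text \<open>Each step of the algorithm keeps the matrix with rows \<open>B\<close> and columns \<open>T\<close> square and
  nonsingular, and the stopping condition makes every linear relation between states that holds on
  \<open>T\<close> hold on all tests. Hence the Hankel rank is \<open>|T|\<close>, and every choice of \<open>|T|\<close> states with
  nonzero determinant on \<open>T\<close> gives unique representations. For a choice of maximal absolute
  determinant, the coefficients of single states are bounded by 1, and those of belief states are
  convex combinations of them; the constant 2 of the paper is not sharp.\<close>

section \<open>Square linear systems indexed by finite sets\<close>

text \<open>Independence of an indexed family rather than of a set of vectors: two indices with the
  same values on \<open>T\<close> count as dependent, which a set of vectors could not
  express.\<close>

definition lin_indep_on :: "('a \<Rightarrow> 't \<Rightarrow> real) \<Rightarrow> 't set \<Rightarrow> 'a set \<Rightarrow> bool" where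
  "lin_indep_on f T B \<longleftrightarrow>
     (\<forall>\<alpha>. (\<forall>t\<in>T. (\<Sum>s\<in>B. \<alpha> s * f s t) = 0) \<longrightarrow> (\<forall>s\<in>B. \<alpha> s = 0))"

lemma lin_indep_onD:
  assumes "lin_indep_on f T B" "\<And>t. t \<in> T \<Longrightarrow> (\<Sum>s\<in>B. \<alpha> s * f s t) = 0" "s \<in> B"
  shows "\<alpha> s = 0"
  using assms unfolding lin_indep_on_def by blast

lemma sum_apply: "(\<Sum>v\<in>A. F v) x = (\<Sum>v\<in>A. F v x)"
  for F :: "'a \<Rightarrow> 'b \<Rightarrow> 'c::comm_monoid_add"
  by (induction A rule: infinite_finite_induct) auto

lemma lin_indep_on_unique:
  assumes "lin_indep_on f T B"
    and "\<And>t. t \<in> T \<Longrightarrow> (\<Sum>s\<in>B. \<alpha> s * f s t) = (\<Sum>s\<in>B. \<beta> s * f s t)" "s \<in> B"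
  shows "\<alpha> s = \<beta> s"
  using lin_indep_onD[OF assms(1), of "\<lambda>s. \<alpha> s - \<beta> s", OF _ assms(3)] assms(2)
  by (simp add: left_diff_distrib sum_subtractf)

text \<open>Eliminating \<open>b\<close> by means of \<open>\<alpha>\<close> turns a relation on
  \<open>insert b B\<close> into one on \<open>B\<close> that holds on \<open>T\<close>, hence is
  trivial. At \<open>z\<close> only the defect of \<open>\<alpha>\<close> multiplied by
  \<open>\<beta> b\<close> remains, and the defect is nonzero. One loop iteration is exactly this
  situation.\<close>

lemma lin_indep_on_insert:
  assumes "finite B" "b \<notin> B" "lin_indep_on f T B"
    and \<alpha>: "\<And>t. t \<in> T \<Longrightarrow> (\<Sum>s\<in>B. \<alpha> s * f s t) = f b t"
    and z: "f b z \<noteq> (\<Sum>s\<in>B. \<alpha> s * f s z)"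
  shows "lin_indep_on f (insert z T) (insert b B)"
  unfolding lin_indep_on_def
proof (intro allI impI)
  fix \<beta> assume \<beta>: "\<forall>t\<in>insert z T. (\<Sum>s\<in>insert b B. \<beta> s * f s t) = 0"
  have split: "(\<Sum>s\<in>B. (\<beta> s + \<beta> b * \<alpha> s) * f s t)
      = (\<Sum>s\<in>insert b B. \<beta> s * f s t) - \<beta> b * (f b t - (\<Sum>s\<in>B. \<alpha> s * f s t))" for t
    using assms(1,2) by (simp add: algebra_simps sum.distrib sum_distrib_left)
  have 0: "\<beta> s + \<beta> b * \<alpha> s = 0" if "s \<in> B" for s
    using lin_indep_onD[OF assms(3) _ that, of "\<lambda>s. \<beta> s + \<beta> b * \<alpha> s"] \<beta> \<alpha> split by simp
  then have "\<beta> b * (f b z - (\<Sum>s\<in>B. \<alpha> s * f s z)) = 0" using split[of z] \<beta> by simp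
  then have "\<beta> b = 0" using z by simp
  then show "\<forall>s\<in>insert b B. \<beta> s = 0" using 0 by simp
qed

text \<open>Lists supply the ordering that a matrix requires. States index the columns, so a product
  with a coefficient vector is a combination of states, and exchanging a state replaces a column, as
  in Cramer's rule.\<close>

definition eval_mat :: "('a \<Rightarrow> 't \<Rightarrow> real) \<Rightarrow> 't list \<Rightarrow> 'a list \<Rightarrow> real mat" where
  "eval_mat f ts bs = Matrix.mat (length ts) (length bs) (\<lambda>(i, j). f (bs ! j) (ts ! i))"

lemma eval_mat_carrier:
  "length bs = length ts \<Longrightarrow> eval_mat f ts bs \<in> carrier_mat (length ts) (length ts)"
  by (simp add: eval_mat_def)

lemma eval_mat_mult_vec:
  assumes "distinct bs" "length bs = length ts"
  shows "eval_mat f ts bs *\<^sub>v Matrix.vec (length ts) (\<lambda>j. \<alpha> (bs ! j))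
    = Matrix.vec (length ts) (\<lambda>i. \<Sum>s\<in>set bs. \<alpha> s * f s (ts ! i))"
proof (rule eq_vecI)
  fix i assume "i < dim_vec (Matrix.vec (length ts) (\<lambda>i. \<Sum>s\<in>set bs. \<alpha> s * f s (ts ! i)))"
  then have i: "i < length ts" by simp
  have "(\<Sum>s\<in>set bs. \<alpha> s * f s (ts ! i)) = (\<Sum>j<length bs. \<alpha> (bs ! j) * f (bs ! j) (ts ! i))"
    by (rule sum.reindex_bij_betw[symmetric, OF bij_betw_nth[OF assms(1) refl refl]])
  then show "vec_index (eval_mat f ts bs *\<^sub>v Matrix.vec (length ts) (\<lambda>j. \<alpha> (bs ! j))) i
    = vec_index (Matrix.vec (length ts) (\<lambda>i. \<Sum>s\<in>set bs. \<alpha> s * f s (ts ! i))) i"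
    using i assms(2)
    by (simp add: eval_mat_def scalar_prod_def lessThan_atLeast0 mult.commute)
qed (simp add: eval_mat_def)

text \<open>Without repetitions the position in \<open>bs\<close> is a function of the element, so
  coordinates can be read as coefficients attached to elements.\<close>

lemma vec_as_combination:
  assumes "distinct bs" "v \<in> carrier_vec (length bs)"
  obtains \<alpha> where "v = Matrix.vec (length bs) (\<lambda>j. \<alpha> (bs ! j))"
proof
  show "v = Matrix.vec (length bs) (\<lambda>j. vec_index v (the_inv_into {..<length bs} ((!) bs) (bs ! j)))"
  proof (rule eq_vecI)
    fix j assume "j < dim_vec (Matrix.vec (length bs)
      (\<lambda>j. vec_index v (the_inv_into {..<length bs} ((!) bs) (bs ! j))))"
    then show "vec_index v j = vec_index (Matrix.vec (length bs)
      (\<lambda>j. vec_index v (the_inv_into {..<length bs} ((!) bs) (bs ! j)))) j"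
      using assms(1) by (simp add: the_inv_into_f_f inj_on_nth)
  qed (use assms in simp)
qed

section \<open>Nonzero determinants, independence and solvability\<close>

lemma det_eval_mat_nonzero:
  assumes "distinct bs" "length bs = length ts" "lin_indep_on f (set ts) (set bs)"
  shows "Determinant.det (eval_mat f ts bs) \<noteq> 0"
proof
  assume "Determinant.det (eval_mat f ts bs) = 0"
  then obtain v where v: "v \<in> carrier_vec (length ts)" "v \<noteq> 0\<^sub>v (length ts)"
      "eval_mat f ts bs *\<^sub>v v = 0\<^sub>v (length ts)"
    using det_0_iff_vec_prod_zero_field[OF eval_mat_carrier[OF assms(2)]] by blast
  obtain \<alpha> where \<alpha>: "v = Matrix.vec (length ts) (\<lambda>j. \<alpha> (bs ! j))"
    using vec_as_combination[OF assms(1)] v(1) assms(2) by metis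
  have "(\<Sum>s\<in>set bs. \<alpha> s * f s (ts ! i)) = 0" if "i < length ts" for i
    using arg_cong[OF v(3)[unfolded \<alpha> eval_mat_mult_vec[OF assms(1,2)]],
        where f="\<lambda>u. vec_index u i"] that by simp
  then have "\<alpha> s = 0" if "s \<in> set bs" for s
    using lin_indep_onD[OF assms(3) _ that] by (metis in_set_conv_nth)
  then have "v = 0\<^sub>v (length ts)"
    unfolding \<alpha> using assms(2) by (intro eq_vecI) auto
  with v(2) show False ..
qed

text \<open>A repeated entry yields two equal columns. This recovers distinctness after maximizing
  over arbitrary lists.\<close>

lemma distinct_if_det_eval_mat:
  assumes "length bs = length ts" "Determinant.det (eval_mat f ts bs) \<noteq> 0"
  shows "distinct bs"
proof (rule ccontr)
  assume "\<not> distinct bs"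
  then obtain i j where ij: "i < length bs" "j < length bs" "i \<noteq> j" "bs ! i = bs ! j"
    by (auto simp: distinct_conv_nth)
  then have "Matrix.col (eval_mat f ts bs) i = Matrix.col (eval_mat f ts bs) j"
    by (intro eq_vecI) (auto simp: eval_mat_def)
  then have "Determinant.det (eval_mat f ts bs) = 0"
    using det_identical_columns[OF eval_mat_carrier[OF assms(1)]] ij assms(1) by auto
  with assms(2) show False ..
qed

lemma lin_indep_on_if_det_eval_mat:
  assumes "length bs = length ts" "Determinant.det (eval_mat f ts bs) \<noteq> 0"
  shows "lin_indep_on f (set ts) (set bs)"
  unfolding lin_indep_on_def
proof (intro allI impI ballI)
  fix \<alpha> s assume \<alpha>: "\<forall>t\<in>set ts. (\<Sum>s\<in>set bs. \<alpha> s * f s t) = 0" and s: "s \<in> set bs"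
  let ?v = "Matrix.vec (length ts) (\<lambda>j. \<alpha> (bs ! j))"
  have "eval_mat f ts bs *\<^sub>v ?v = 0\<^sub>v (length ts)"
    unfolding eval_mat_mult_vec[OF distinct_if_det_eval_mat[OF assms] assms(1)]
    using \<alpha> by (intro eq_vecI) auto
  then have "?v = 0\<^sub>v (length ts)"
    using det_0_iff_vec_prod_zero_field[OF eval_mat_carrier[OF assms(1)]] assms(2)
    by (metis vec_carrier)
  then have "vec_index ?v j = 0" if "j < length ts" for j using that by simp
  then show "\<alpha> s = 0"
    using s assms(1) by (auto simp: in_set_conv_nth)
qed

lemma solvable_if_det_eval_mat:
  assumes "length bs = length ts" "distinct ts" "Determinant.det (eval_mat f ts bs) \<noteq> 0"
  shows "\<exists>\<alpha>. \<forall>t\<in>set ts. (\<Sum>s\<in>set bs. \<alpha> s * f s t) = g t"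
proof -
  let ?n = "length ts" and ?A = "eval_mat f ts bs"
  have A: "?A \<in> carrier_mat ?n ?n" by (rule eval_mat_carrier[OF assms(1)])
  \<comment> \<open>An invertible matrix is a unit of the matrix ring; \<open>()\<close> fills the
    extension slot of the ring record. The coefficients sought are the entries of \<open>C\<close>
    applied to \<open>g\<close>.\<close>
  obtain C where C: "C \<in> carrier_mat ?n ?n" "?A * C = 1\<^sub>m ?n"
    using det_non_zero_imp_unit[OF A assms(3), of "()"]
    unfolding Units_def ring_mat_def by auto
  let ?g = "Matrix.vec ?n (\<lambda>i. g (ts ! i))"
  have d: "distinct bs" by (rule distinct_if_det_eval_mat[OF assms(1,3)])
  have "C *\<^sub>v ?g \<in> carrier_vec (length bs)" using C(1) assms(1) by simp
  then obtain \<alpha> where \<alpha>: "C *\<^sub>v ?g = Matrix.vec ?n (\<lambda>j. \<alpha> (bs ! j))"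
    using vec_as_combination[OF d] assms(1) by metis
  have "?A *\<^sub>v (C *\<^sub>v ?g) = (?A * C) *\<^sub>v ?g"
    using A C(1) by (intro assoc_mult_mat_vec[symmetric]) auto
  then have "?A *\<^sub>v (C *\<^sub>v ?g) = ?g" using C(2) by simp
  then have eq: "Matrix.vec ?n (\<lambda>i. \<Sum>s\<in>set bs. \<alpha> s * f s (ts ! i)) = ?g"
    unfolding \<alpha> eval_mat_mult_vec[OF d assms(1)] .
  have "(\<Sum>s\<in>set bs. \<alpha> s * f s (ts ! i)) = g (ts ! i)" if "i < ?n" for i
    using arg_cong[OF eq, where f="\<lambda>u. vec_index u i"] that by simp
  then show ?thesis by (metis in_set_conv_nth)
qed

lemma lin_indep_on_solvable:
  assumes "finite B" "finite T" "card B = card T" "lin_indep_on f T B"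
  shows "\<exists>\<alpha>. \<forall>t\<in>T. (\<Sum>s\<in>B. \<alpha> s * f s t) = g t"
proof -
  obtain bs ts where bs: "distinct bs" "set bs = B" and ts: "distinct ts" "set ts = T"
    using assms(1,2) finite_distinct_list by metis
  then have l: "length bs = length ts" using assms(3) distinct_card by metis
  show ?thesis
    using solvable_if_det_eval_mat[OF l ts(1) det_eval_mat_nonzero[OF bs(1) l]] assms(4) bs ts
    by simp
qed

text \<open>A basis of maximal volume is a barycentric spanner: by Cramer's rule, each coefficient of
  \<open>v\<close> is the ratio between the determinant after replacing one basis element by \<open>v\<close> and the
  maximal determinant.\<close>

lemma barycentric_spanner_exists:
  assumes "finite S" "finite T" "B\<^sub>0 \<subseteq> S" "card B\<^sub>0 = card T" "lin_indep_on f T B\<^sub>0"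
  obtains B where "B \<subseteq> S" "card B = card T" "lin_indep_on f T B"
    "\<And>v \<alpha> s. v \<in> S \<Longrightarrow> (\<And>t. t \<in> T \<Longrightarrow> (\<Sum>s\<in>B. \<alpha> s * f s t) = f v t) \<Longrightarrow> s \<in> B \<Longrightarrow> \<bar>\<alpha> s\<bar> \<le> 1"
proof -
  have "finite B\<^sub>0" using assms(1,3) finite_subset by blast
  then obtain bs\<^sub>0 ts where bs0: "distinct bs\<^sub>0" "set bs\<^sub>0 = B\<^sub>0" and ts: "distinct ts" "set ts = T"
    using assms(2) finite_distinct_list by metis
  have l0: "length bs\<^sub>0 = length ts" using bs0 ts assms(4) distinct_card by metis
  let ?L = "{bs. set bs \<subseteq> S \<and> length bs = length ts}"
  let ?d = "\<lambda>bs. \<bar>Determinant.det (eval_mat f ts bs)\<bar>"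
  have L: "finite ?L" "bs\<^sub>0 \<in> ?L"
    using finite_lists_length_eq[OF assms(1)] bs0 l0 assms(3) by auto
  have "Max (?d ` ?L) \<in> ?d ` ?L" by (rule Max_in) (use L in blast)+
  then obtain bs where bs: "bs \<in> ?L" and Max_eq: "Max (?d ` ?L) = ?d bs" by blast
  have maxi: "?d cs \<le> ?d bs" if "cs \<in> ?L" for cs
    unfolding Max_eq[symmetric] by (rule Max_ge) (use L that in blast)+
  have l: "length bs = length ts" using bs by simp
  have nz: "Determinant.det (eval_mat f ts bs) \<noteq> 0"
    using maxi[OF L(2)] det_eval_mat_nonzero[OF bs0(1) l0] assms(5) bs0 ts by force
  have d: "distinct bs" by (rule distinct_if_det_eval_mat[OF l nz])
  show ?thesis
  proof (rule that[of "set bs"])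
    show "set bs \<subseteq> S" using bs by simp
    show "card (set bs) = card T" using distinct_card d l ts by metis
    show "lin_indep_on f T (set bs)" using lin_indep_on_if_det_eval_mat[OF l nz] ts by simp
    fix v \<alpha> s assume v: "v \<in> S" and \<alpha>: "\<And>t. t \<in> T \<Longrightarrow> (\<Sum>s\<in>set bs. \<alpha> s * f s t) = f v t"
      and "s \<in> set bs"
    then obtain k where k: "k < length ts" "bs ! k = s" using l by (metis in_set_conv_nth)
    let ?x = "Matrix.vec (length ts) (\<lambda>j. \<alpha> (bs ! j))"
    \<comment> \<open>By the choice of \<open>\<alpha>\<close>, the product with \<open>?x\<close>
      is the column of values of \<open>v\<close>.\<close>
    have "replace_col (eval_mat f ts bs) (eval_mat f ts bs *\<^sub>v ?x) k = eval_mat f ts (bs[k := v])"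
      unfolding eval_mat_mult_vec[OF d l]
      using \<alpha> ts k l by (intro eq_matI) (auto simp: replace_col_def eval_mat_def)
    then have "Determinant.det (eval_mat f ts (bs[k := v]))
        = \<alpha> s * Determinant.det (eval_mat f ts bs)"
      using cramer_lemma_mat[OF eval_mat_carrier[OF l, of f], of ?x k] k by simp
    moreover have "bs[k := v] \<in> ?L"
      using v bs set_update_subset_insert[of bs k v] by auto
    ultimately have "\<bar>\<alpha> s\<bar> * ?d bs \<le> 1 * ?d bs" using maxi by (metis abs_mult mult_1)
    then show "\<bar>\<alpha> s\<bar> \<le> 1" using nz by (metis mult_le_cancel_right_pos zero_less_abs_iff)
  qed
qed

section \<open>Invariants and correctness of the algorithm\<close>

text \<open>Both sides of the vector equation vanish outside \<open>T\<close>, so only the entries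
  at tests in \<open>T\<close> matter.\<close>

lemma represents_iff:
  assumes "finite (states M)" "B \<subseteq> states M"
  shows "represents M T B \<alpha> b \<longleftrightarrow>
    (\<forall>t\<in>T. (\<Sum>s\<in>B. \<alpha> s * state_prob M t s) = test_prob M t b)"
proof -
  have "(\<Sum>s\<in>B. \<alpha> s * test_vector M T (return_pmf s) t)
      = (if t \<in> T then \<Sum>s\<in>B. \<alpha> s * state_prob M t s else 0)" for t
    using assms by (auto simp: test_vector_def test_prob_return_pmf subset_iff intro!: sum.cong)
  then show ?thesis
    unfolding represents_def fun_eq_iff by (auto simp: test_vector_def[of _ _ b])
qed

lemma alg_reaches_invariant:
  assumes "finite (states M)" "s1 \<in> states M" "alg_reaches M s1 B T"
  shows "B \<subseteq> states M \<and> B \<noteq> {} \<and> [] \<in> T \<and> T \<subseteq> tests M \<and> finite T \<and> card B = card T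
    \<and> lin_indep_on (\<lambda>s t. state_prob M t s) T B"
  using assms(3)
proof induction
  case init
  then show ?case using assms(2) by (simp add: tests_def lin_indep_on_def)
next
  case (step B T b \<sigma> y)
  have fin: "finite B" using step.IH assms(1) finite_subset by blast
  obtain \<alpha> where b: "\<sigma> \<in> alphabet M" "b \<in> states M" "b \<notin> B" "y \<in> T"
    and \<alpha>: "represents M T B \<alpha> (return_pmf b)"
    and "test_prob M (\<sigma> # y) (return_pmf b)
            \<noteq> (\<Sum>s\<in>B. \<alpha> s * test_prob M (\<sigma> # y) (return_pmf s))"
    using step.hyps(2) unfolding extendable_def by blast
  moreover have "(\<Sum>s\<in>B. \<alpha> s * test_prob M (\<sigma> # y) (return_pmf s))
      = (\<Sum>s\<in>B. \<alpha> s * state_prob M (\<sigma> # y) s)"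
    using step.IH assms(1)
    by (intro sum.cong) (auto simp del: state_prob.simps simp: test_prob_return_pmf subset_iff)
  ultimately have z: "state_prob M (\<sigma> # y) b \<noteq> (\<Sum>s\<in>B. \<alpha> s * state_prob M (\<sigma> # y) s)"
    using assms(1) by (simp del: state_prob.simps add: test_prob_return_pmf)
  have rep: "(\<Sum>s\<in>B. \<alpha> s * state_prob M t s) = state_prob M t b" if "t \<in> T" for t
    using \<alpha> represents_iff[OF assms(1)] step.IH that b assms(1)
    by (simp add: test_prob_return_pmf)
  \<comment> \<open>The combination is exact on \<open>T\<close> but fails at the new test; hence
    \<open>B\<close> and \<open>T\<close> both grow by exactly one element.\<close>
  have "\<sigma> # y \<notin> T" using z rep by metis
  moreover have "lin_indep_on (\<lambda>s t. state_prob M t s) (insert (\<sigma> # y) T) (insert b B)"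
    by (rule lin_indep_on_insert[where \<alpha>=\<alpha>]) (use fin b step.IH rep z in \<open>simp_all del: state_prob.simps\<close>)
  moreover have "\<sigma> # y \<in> tests M" using b step.IH unfolding tests_def by auto
  ultimately show ?case using fin b step.IH by simp
qed

text \<open>At termination, the vectors orthogonal to all columns in \<open>T\<close> form a subspace that is stable
  under every one-step operator of the POMDP; since it is orthogonal to the empty test, it is
  orthogonal to every test.\<close>

lemma alg_output_kernel:
  assumes fin: "finite (states M)" and "s1 \<in> states M" and out: "alg_output M s1 B T"
    and "t \<in> tests M"
    and "\<And>t. t \<in> T \<Longrightarrow> (\<Sum>s\<in>states M. w s * state_prob M t s) = 0"
  shows "(\<Sum>s\<in>states M. w s * state_prob M t s) = 0"
proof -
  have inv: "B \<subseteq> states M" "[] \<in> T" "finite T" "card B = card T" "lin_indep_on (\<lambda>s t. state_prob M t s) T B"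
    and stop: "\<And>b \<sigma> y. \<not> extendable M B T b \<sigma> y"
    using alg_reaches_invariant[OF fin assms(2)] out unfolding alg_output_def by auto
  have finB: "finite B" using inv(1) fin finite_subset by blast
  \<comment> \<open>Every state has coefficients over \<open>B\<close> that are valid both on
    \<open>T\<close> and on all one-letter extensions of \<open>T\<close>. The loop condition
    concerns only states outside \<open>B\<close>; a state of \<open>B\<close> represents
    itself.\<close>
  have "\<exists>\<alpha>. (\<forall>t\<in>T. (\<Sum>b\<in>B. \<alpha> b * state_prob M t b) = state_prob M t s) \<and>
      (\<forall>\<sigma>\<in>alphabet M. \<forall>y\<in>T. (\<Sum>b\<in>B. \<alpha> b * state_prob M (\<sigma> # y) b) = state_prob M (\<sigma> # y) s)"
    if s: "s \<in> states M" for s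
  proof (cases "s \<in> B")
    case True
    then have "(\<Sum>b\<in>B. (if b = s then 1 else 0) * state_prob M t b) = state_prob M t s" for t
      using finB by (simp add: if_distrib[of "\<lambda>c. c * _"] cong: if_cong)
    then show ?thesis by (intro exI[of _ "\<lambda>b. if b = s then 1 else 0"]) blast
  next
    case False
    have "\<exists>\<alpha>. \<forall>t\<in>T. (\<Sum>b\<in>B. \<alpha> b * state_prob M t b) = state_prob M t s"
      by (rule lin_indep_on_solvable[OF finB inv(3,4,5)])
    then obtain \<alpha> where \<alpha>: "\<forall>t\<in>T. (\<Sum>b\<in>B. \<alpha> b * state_prob M t b) = state_prob M t s"
      by blast
    then have "represents M T B \<alpha> (return_pmf s)"
      using represents_iff[OF fin inv(1)] s fin by (simp add: test_prob_return_pmf)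
    then have "(\<Sum>b\<in>B. \<alpha> b * test_prob M (\<sigma> # y) (return_pmf b)) = test_prob M (\<sigma> # y) (return_pmf s)"
      if "\<sigma> \<in> alphabet M" "y \<in> T" for \<sigma> y
      using stop[of s \<sigma> y] that s False unfolding extendable_def by auto
    moreover have "(\<Sum>b\<in>B. \<alpha> b * test_prob M (\<sigma> # y) (return_pmf b))
      = (\<Sum>b\<in>B. \<alpha> b * state_prob M (\<sigma> # y) b)" for \<sigma> y
      using inv(1) fin
      by (intro sum.cong) (auto simp del: state_prob.simps simp: test_prob_return_pmf subset_iff)
    ultimately show ?thesis
      using \<alpha> s fin by (auto simp del: state_prob.simps simp: test_prob_return_pmf)
  qed
  then have "\<exists>c. \<forall>s\<in>states M.
      (\<forall>t\<in>T. (\<Sum>b\<in>B. c s b * state_prob M t b) = state_prob M t s) \<and>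
      (\<forall>\<sigma>\<in>alphabet M. \<forall>y\<in>T. (\<Sum>b\<in>B. c s b * state_prob M (\<sigma> # y) b) = state_prob M (\<sigma> # y) s)"
    by (intro bchoice ballI)
  then obtain c where
      cT: "\<And>s t. s \<in> states M \<Longrightarrow> t \<in> T \<Longrightarrow> (\<Sum>b\<in>B. c s b * state_prob M t b) = state_prob M t s"
    and cS: "\<And>s \<sigma> y. s \<in> states M \<Longrightarrow> \<sigma> \<in> alphabet M \<Longrightarrow> y \<in> T \<Longrightarrow>
          (\<Sum>b\<in>B. c s b * state_prob M (\<sigma> # y) b) = state_prob M (\<sigma> # y) s"
    by blast
  have comb: "(\<Sum>b\<in>B. (\<Sum>s\<in>states M. w s * c s b) * state_prob M t b)
      = (\<Sum>s\<in>states M. w s * (\<Sum>b\<in>B. c s b * state_prob M t b))" for w :: "'a \<Rightarrow> real" and t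
    by (simp add: sum_distrib_left sum_distrib_right mult.assoc) (rule sum.swap)
  \<comment> \<open>Rewriting each state through \<open>c\<close> turns orthogonality to
    \<open>T\<close> into a relation over \<open>B\<close> on \<open>T\<close>. Independence makes
    its coefficients vanish, and the same coefficients compute the sum at
    \<open>\<sigma> # y\<close>.\<close>
  have step: "(\<Sum>s\<in>states M. w s * state_prob M (\<sigma> # y) s) = 0"
    if "\<sigma> \<in> alphabet M" "y \<in> T"
      and orth: "\<And>t. t \<in> T \<Longrightarrow> (\<Sum>s\<in>states M. w s * state_prob M t s) = 0"
    for w \<sigma> y
  proof -
    have "(\<Sum>b\<in>B. (\<Sum>s\<in>states M. w s * c s b) * state_prob M t b) = 0" if "t \<in> T" for t
      unfolding comb using cT that orth by simp
    then have "(\<Sum>s\<in>states M. w s * c s b) = 0" if "b \<in> B" for b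
      using lin_indep_onD[OF inv(5) _ that, of "\<lambda>b. \<Sum>s\<in>states M. w s * c s b"] by simp
    then have "(\<Sum>s\<in>states M. w s * (\<Sum>b\<in>B. c s b * state_prob M (\<sigma> # y) b)) = 0"
      unfolding comb[symmetric] by simp
    then show ?thesis using cS that(1,2) by simp
  qed
  show ?thesis
    using assms(4,5)
  \<comment> \<open>The weights must vary: stripping the first letter from a test replaces
    \<open>w\<close> by its image under the one-step operator of that letter.\<close>
  proof (induction t arbitrary: w)
    case Nil
    then show ?case using inv(2) by blast
  next
    case (Cons \<sigma> u)
    obtain a o' where \<sigma>: "\<sigma> = (a, o')" by (rule prod.exhaust)
    let ?w = "\<lambda>s'. \<Sum>s\<in>states M. w s * joint_prob M s' o' a s"
    have push: "(\<Sum>s\<in>states M. w s * state_prob M (\<sigma> # y) s)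
        = (\<Sum>s'\<in>states M. ?w s' * state_prob M y s')" for y
      by (simp add: \<sigma> sum_distrib_left sum_distrib_right mult.assoc) (rule sum.swap)
    have "\<sigma> \<in> alphabet M" "u \<in> tests M" using Cons.prems(1) by (auto simp: tests_def)
    then show ?case
      unfolding push using step[of \<sigma> _ w] Cons.prems(2) by (intro Cons.IH) (auto simp: push)
  qed
qed

section \<open>Rank of the Hankel matrix\<close>

lemma alg_output_hankel_rank:
  assumes fin: "finite (states M)" and s1: "s1 \<in> states M" and out: "alg_output M s1 B T"
  shows "hankel_rank M = card B"
proof -
  have inv: "B \<subseteq> states M" "T \<subseteq> tests M" "finite T" "card B = card T" "lin_indep_on (\<lambda>s t. state_prob M t s) T B"
    using alg_reaches_invariant[OF fin s1] out unfolding alg_output_def by auto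
  have finB: "finite B" using inv(1) fin finite_subset by blast
  let ?r = "\<lambda>s. test_vector M (tests M) (return_pmf s)"
  have r: "?r s t = (if t \<in> tests M then state_prob M t s else 0)" if "s \<in> B" for s t
    using that inv(1) fin by (auto simp: test_vector_def test_prob_return_pmf subset_iff)
  \<comment> \<open>Two states with equal rows would give two different coefficient families for the
    same values on \<open>T\<close>. Injectivity carries independence of the family \<open>B\<close>
    over to the set of its rows.\<close>
  have inj: "inj_on ?r B"
  proof (rule inj_onI)
    fix x y assume xy: "x \<in> B" "y \<in> B" and eq: "?r x = ?r y"
    have "state_prob M t x = state_prob M t y" if "t \<in> T" for t
      using fun_cong[OF eq, of t] r xy that inv(2) by (auto split: if_splits)
    then have "(\<Sum>s\<in>B. (if s = x then 1 else 0) * state_prob M t s)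
       = (\<Sum>s\<in>B. (if s = y then 1 else 0) * state_prob M t s)" if "t \<in> T" for t
      using that finB xy by (simp add: if_distrib[of "\<lambda>c. c * _"] cong: if_cong)
    from lin_indep_on_unique[OF inv(5) this xy(1)] show "x = y" by (simp split: if_splits)
  qed
  have indep: "real_fun.independent (?r ` B)"
  proof (rule real_fun.independent_if_scalars_zero)
    fix g x assume g: "(\<Sum>v\<in>?r ` B. (\<lambda>i. g v * v i)) = 0" and "x \<in> ?r ` B"
    then obtain s where s: "s \<in> B" "x = ?r s" by blast
    have "(\<Sum>s\<in>B. g (?r s) * state_prob M t s) = 0" if "t \<in> T" for t
    proof -
      have "(\<Sum>s\<in>B. g (?r s) * ?r s t) = (\<Sum>v\<in>?r ` B. (\<lambda>i. g v * v i)) t"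
        by (simp add: sum.reindex[OF inj] sum_apply)
      then show ?thesis using g r that inv(2) by (auto simp: subset_iff)
    qed
    from lin_indep_onD[OF inv(5) this s(1)] show "g x = 0" using s by simp
  qed (use finB in simp)
  have "test_vector M (tests M) b \<in> real_fun.span (?r ` B)" for b
  proof -
    obtain \<alpha> where \<alpha>: "\<And>t. t \<in> T \<Longrightarrow> (\<Sum>s\<in>B. \<alpha> s * state_prob M t s) = test_prob M t b"
      using lin_indep_on_solvable[OF finB inv(3,4,5), of "\<lambda>t. test_prob M t b"] by auto
    \<comment> \<open>The difference between \<open>b\<close> and its combination over
      \<open>B\<close> is orthogonal to \<open>T\<close> by the choice of \<open>\<alpha>\<close>,
      hence to every test. So the rows of \<open>B\<close> span the row space.\<close>
    let ?w = "\<lambda>s. pmf b s - (if s \<in> B then \<alpha> s else 0)"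
    have w: "(\<Sum>s\<in>states M. ?w s * state_prob M t s)
        = test_prob M t b - (\<Sum>s\<in>B. \<alpha> s * state_prob M t s)" for t
      using fin inv(1)
      by (simp add: left_diff_distrib sum_subtractf test_prob_def if_distrib[of "\<lambda>c. c * _"]
          sum.If_cases Int_absorb1 cong: if_cong)
    have "test_prob M t b = (\<Sum>s\<in>B. \<alpha> s * state_prob M t s)" if "t \<in> tests M" for t
      using alg_output_kernel[OF fin s1 out that, of ?w] \<alpha> w by simp
    then have "test_vector M (tests M) b = (\<Sum>s\<in>B. (\<lambda>i. \<alpha> s * ?r s i))"
      using r by (auto simp: fun_eq_iff sum_apply test_vector_def[of _ _ b])
    then show ?thesis
      by (simp add: real_fun.span_sum real_fun.span_scale real_fun.span_base)
  qed
  then have "test_vector M (tests M) ` belief_states M \<subseteq> real_fun.span (?r ` B)" by blast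
  moreover have "?r ` B \<subseteq> test_vector M (tests M) ` belief_states M"
    using inv(1) by (auto simp: belief_states_def)
  ultimately show ?thesis
    unfolding hankel_rank_def using indep card_image[OF inj] by (metis real_fun.dim_unique)
qed

section \<open>Unique representations with bounded coefficients\<close>

theorem theorem5p3:
  fixes M :: "('s, 'a, 'o) pomdp" and s1 :: 's
    and B\<^sub>0 :: "'s set" and T :: "('a, 'o) test set"
  assumes "is_pomdp M"
    and "s1 \<in> states M"
    and "alg_output M s1 B\<^sub>0 T"
  shows "\<exists>B \<subseteq> states M. card B = hankel_rank M \<and>
           (\<forall>b \<in> belief_states M.
              (\<exists>!\<alpha>. \<alpha> \<in> extensional B \<and> represents M T B \<alpha> b) \<and>
              (\<forall>\<alpha>. represents M T B \<alpha> b \<longrightarrow> (MAX s\<in>B. \<bar>\<alpha> s\<bar>) \<le> 2))"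
proof -
  have fin: "finite (states M)" using assms(1) by (simp add: is_pomdp_def)
  have inv: "B\<^sub>0 \<subseteq> states M" "[] \<in> T" "finite T" "card B\<^sub>0 = card T" "lin_indep_on (\<lambda>s t. state_prob M t s) T B\<^sub>0"
    using alg_reaches_invariant[OF fin assms(2)] assms(3) unfolding alg_output_def by auto
  obtain B where B: "B \<subseteq> states M" "card B = card T" "lin_indep_on (\<lambda>s t. state_prob M t s) T B"
    and le1: "\<And>v \<alpha> s. v \<in> states M \<Longrightarrow>
      (\<And>t. t \<in> T \<Longrightarrow> (\<Sum>s\<in>B. \<alpha> s * state_prob M t s) = state_prob M t v) \<Longrightarrow> s \<in> B \<Longrightarrow> \<bar>\<alpha> s\<bar> \<le> 1"
    using barycentric_spanner_exists[OF fin inv(3,1,4,5)] by blast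
  have finB: "finite B" using B(1) fin finite_subset by blast
  \<comment> \<open>The maximum is taken over a nonempty set because \<open>T\<close> contains the
    empty test.\<close>
  have neB: "B \<noteq> {}" using B(2) inv(2,3) by auto
  note rep = represents_iff[OF fin B(1)]
  note solvable = lin_indep_on_solvable[OF finB inv(3) B(2,3)]
  have "\<exists>\<gamma>. \<forall>t\<in>T. (\<Sum>s\<in>B. \<gamma> s * state_prob M t s) = state_prob M t v" for v
    by (rule solvable)
  then obtain c where c: "\<And>v t. t \<in> T \<Longrightarrow> (\<Sum>s\<in>B. c v s * state_prob M t s) = state_prob M t v"
    by metis
  have "\<exists>!\<alpha>. \<alpha> \<in> extensional B \<and> represents M T B \<alpha> b" for b
  proof -
    obtain \<alpha> where "\<forall>t\<in>T. (\<Sum>s\<in>B. \<alpha> s * state_prob M t s) = test_prob M t b"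
      using solvable by meson
    \<comment> \<open>Only the values on \<open>B\<close> are determined by the equations, so
      uniqueness is stated for functions that are \<open>undefined\<close> elsewhere.\<close>
    then have "restrict \<alpha> B \<in> extensional B \<and> represents M T B (restrict \<alpha> B) b"
      by (simp add: rep)
    moreover have "\<alpha> = \<beta>" if "\<alpha> \<in> extensional B \<and> represents M T B \<alpha> b"
      "\<beta> \<in> extensional B \<and> represents M T B \<beta> b" for \<alpha> \<beta>
      using that lin_indep_on_unique[OF B(3), of \<alpha> \<beta>]
      by (intro extensionalityI[of _ B]) (auto simp: rep)
    ultimately show ?thesis by blast
  qed
  moreover have "(MAX s\<in>B. \<bar>\<alpha> s\<bar>) \<le> 2"
    if b: "b \<in> belief_states M" and \<alpha>: "represents M T B \<alpha> b" for b \<alpha>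
  proof -
    have mass: "(\<Sum>v\<in>states M. pmf b v) = 1"
      using b fin by (intro sum_pmf_eq_1) (auto simp: belief_states_def)
    have "\<bar>\<alpha> s\<bar> \<le> 1" if s: "s \<in> B" for s
    proof -
      \<comment> \<open>Averaging the coefficients \<open>c v\<close> of the single states with the
        weights of \<open>b\<close> represents \<open>b\<close>; uniqueness then identifies
        \<open>\<alpha>\<close> with this average.\<close>
      have "(\<Sum>s\<in>B. (\<Sum>v\<in>states M. pmf b v * c v s) * state_prob M t s) = test_prob M t b"
        if "t \<in> T" for t
      proof -
        have "(\<Sum>s\<in>B. (\<Sum>v\<in>states M. pmf b v * c v s) * state_prob M t s)
            = (\<Sum>v\<in>states M. pmf b v * (\<Sum>s\<in>B. c v s * state_prob M t s))"
          by (simp add: sum_distrib_left sum_distrib_right mult.assoc) (rule sum.swap)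
        then show ?thesis using c that by (simp add: test_prob_def)
      qed
      then have "\<alpha> s = (\<Sum>v\<in>states M. pmf b v * c v s)"
        using lin_indep_on_unique[OF B(3) _ s, of \<alpha> "\<lambda>s. \<Sum>v\<in>states M. pmf b v * c v s"] \<alpha>
        unfolding rep by simp
      also have "\<bar>\<dots>\<bar> \<le> (\<Sum>v\<in>states M. \<bar>pmf b v * c v s\<bar>)" by (rule sum_abs)
      \<comment> \<open>The spanner property bounds each \<open>c v s\<close> by 1 in absolute
        value.\<close>
      also have "\<dots> \<le> (\<Sum>v\<in>states M. pmf b v)"
        using le1[of _ "c _", OF _ c s] by (intro sum_mono) (simp add: abs_mult mult_left_le)
      finally show ?thesis using mass by simp
    qed
    then have "\<bar>\<alpha> s\<bar> \<le> 2" if "s \<in> B" for s using that by fastforce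
    then show ?thesis using finB neB by simp
  qed
  ultimately show ?thesis
    using B alg_output_hankel_rank[OF fin assms(2,3)] inv(4) by (intro exI[of _ B]) simp
qed

end
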